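(* If $A\in\mathbb{R}^{n\times n}$ has a complex (non-real) eigenvalue then $A$ is not an EP-matrix.
   Context: A matrix in $\mathbb{R}^{n\times n}$ is called a P-matrix if all its principal minors are positive. A matrix $A\in\mathbb{R}^{n\times n}$ is called an EP-matrix (exponential P-matrix) if $\exp(At)$ is a P-matrix for all $t\ge 0$. *)

theory Defs
  imports
    Complex_Main
    "Jordan_Normal_Form.DL_Submatrix"
    "Jordan_Normal_Form.Char_Poly"
begin

definition P_matrix :: "real mat \<Rightarrow> bool" where
  "P_matrix A \<longleftrightarrow> square_mat A \<and>
     (\<forall>I. I \<noteq> {} \<and> I \<subseteq> {0..<dim_row A} \<longrightarrow> det (submatrix A I I) > 0)"

text \<open>There is no topology on the type of matrices of arbitrary dimension, so the power series
  of the exponential is summed entrywise; the lemma \<open>summable_mat_exp\<close> shows that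
  all these series converge.\<close>

definition mat_exp :: "real mat \<Rightarrow> real mat" where
  "mat_exp A = mat (dim_row A) (dim_col A) (\<lambda>(i, j). \<Sum>k. (A ^\<^sub>m k) $$ (i, j) / fact k)"

definition EP_matrix :: "real mat \<Rightarrow> bool" where
  "EP_matrix A \<longleftrightarrow> square_mat A \<and> (\<forall>t\<ge>0. P_matrix (mat_exp (t \<cdot>\<^sub>m A)))"

lemma abs_pow_mat_entry_le:
  fixes A :: "real mat"
  assumes A: "A \<in> carrier_mat n n"
    and C: "\<And>i j. i < n \<Longrightarrow> j < n \<Longrightarrow> \<bar>A $$ (i, j)\<bar> \<le> C"
    and i: "i < n" and j: "j < n"
  shows "\<bar>(A ^\<^sub>m k) $$ (i, j)\<bar> \<le> (real n * C) ^ k"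
  using j
proof (induction k arbitrary: j)
  case 0
  then show ?case using A i by auto
next
  case (Suc k)
  have C0: "0 \<le> C" using C[OF i i] by linarith
  have "(A ^\<^sub>m Suc k) $$ (i, j) = (\<Sum>l = 0..<n. (A ^\<^sub>m k) $$ (i, l) * A $$ (l, j))"
    using A i Suc.prems by (simp add: scalar_prod_def)
  then have "\<bar>(A ^\<^sub>m Suc k) $$ (i, j)\<bar> \<le> (\<Sum>l = 0..<n. \<bar>(A ^\<^sub>m k) $$ (i, l)\<bar> * \<bar>A $$ (l, j)\<bar>)"
    by (simp add: sum_abs flip: abs_mult)
  also have "\<dots> \<le> (\<Sum>l = 0..<n. (real n * C) ^ k * C)"
    using Suc.IH Suc.prems C C0 by (intro sum_mono mult_mono) auto
  finally show ?case by (simp add: mult_ac)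
qed

lemma summable_mat_exp:
  fixes A :: "real mat"
  assumes A: "A \<in> carrier_mat n n" and i: "i < n" and j: "j < n"
  shows "summable (\<lambda>k. (A ^\<^sub>m k) $$ (i, j) / fact k)"
proof -
  define C where "C = Max ((\<lambda>p. \<bar>A $$ p\<bar>) ` ({..<n} \<times> {..<n}))"
  have "\<bar>A $$ (a, b)\<bar> \<le> C" if "a < n" "b < n" for a b
    unfolding C_def using that by (intro Max_ge) auto
  then have le: "\<bar>(A ^\<^sub>m k) $$ (i, j)\<bar> \<le> (real n * C) ^ k" for k
    using abs_pow_mat_entry_le[OF A _ i j] by blast
  have "norm ((A ^\<^sub>m k) $$ (i, j) / fact k) \<le> inverse (fact k) * (real n * C) ^ k" for k
    using le[of k] by (simp add: field_simps)
  then show ?thesis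
    by (intro summable_comparison_test[OF _ summable_exp]) blast
qed

end

theory Submission
  imports Defs
begin

text \<open>A P-matrix has no real eigenvalue \<open>r \<le> 0\<close>, since raising diagonal entries one at a time
  never decreases a principal minor: the determinant is affine in each diagonal entry, with the
  complementary principal minor as slope. If \<open>A\<close> has the eigenvalue \<open>z = a + \<i> b\<close> with
  \<open>b \<noteq> 0\<close>, then for \<open>t = pi / \<bar>b\<bar>\<close> the number \<open>exp (t * z) = - exp (t * a) < 0\<close> is an
  eigenvalue of the exponential of \<open>t A\<close>.\<close>

section \<open>Changing one diagonal entry of a principal submatrix\<close>

text \<open>Laplace expansion along row \<open>p\<close>: its cofactors ignore row \<open>p\<close>
  itself, so they agree for \<open>A\<close> and \<open>B\<close>, and the sign at
  \<open>(p, p)\<close> is positive.\<close>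

lemma det_update_diagonal:
  fixes A :: "'a :: comm_ring_1 mat"
  assumes A: "A \<in> carrier_mat n n" and B: "B \<in> carrier_mat n n" and p: "p < n"
    and eq: "\<And>i j. i < n \<Longrightarrow> j < n \<Longrightarrow>
      B $$ (i, j) = A $$ (i, j) + (if i = p \<and> j = p then d else 0)"
  shows "det B = det A + d * det (mat_delete A p p)"
proof -
  have "mat_delete B p j = mat_delete A p j" if "j < n" for j
    using A B that p by (intro eq_matI) (auto simp: mat_delete_def eq)
  then have cof: "cofactor B p j = cofactor A p j" if "j < n" for j
    using that by (simp add: cofactor_def)
  have "det B = (\<Sum>j<n. B $$ (p, j) * cofactor B p j)"
    by (rule laplace_expansion_row[OF B p])
  also have "\<dots> = (\<Sum>j<n. A $$ (p, j) * cofactor A p j + (if j = p then d * cofactor A p p else 0))"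
    using p by (intro sum.cong) (auto simp: eq cof algebra_simps)
  also have "\<dots> = det A + d * cofactor A p p"
    using p by (simp add: sum.distrib laplace_expansion_row[OF A p])
  finally show ?thesis by (simp add: cofactor_def)
qed

lemma pick_eq_iff:
  assumes "i < card S" and "j < card S"
  shows "pick S i = pick S j \<longleftrightarrow> i = j"
  using card_pick_le[OF assms(1)] card_pick_le[OF assms(2)] by metis

text \<open>The position of an element in a set is the number of smaller elements. Removing
  \<open>pick I p\<close> lowers this number by one exactly for the larger elements, which is the
  shift that \<open>insert_index p\<close> undoes.\<close>

lemma pick_remove:
  assumes I: "finite I" and p: "p < card I" and i: "Suc i < card I"
  shows "pick (I - {pick I p}) i = pick I (insert_index p i)"
proof -
  let ?k = "insert_index p i"
  let ?x = "pick I ?k"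
  have k: "?k < card I" and kp: "?k \<noteq> p" using i by (auto simp: insert_index_def)
  have less: "pick I p < ?x \<longleftrightarrow> p < ?k"
    using pick_mono_le[of ?k I p] pick_mono_le[of p I ?k] k p kp by (metis linorder_cases not_less_iff_gr_or_eq)
  have x: "?x \<in> I - {pick I p}"
    using pick_in_set_le[OF k] pick_eq_iff[OF k p] kp by auto
  have eq: "{a \<in> I - {pick I p}. a < ?x} = {a \<in> I. a < ?x} - {pick I p}" by auto
  have "card {a \<in> I - {pick I p}. a < ?x} = i"
  proof (cases "p < ?k")
    case True
    then have "pick I p \<in> {a \<in> I. a < ?x}" using less pick_in_set_le[OF p] by auto
    then have "card {a \<in> I - {pick I p}. a < ?x} = ?k - 1"
      unfolding eq using I card_pick_le[OF k] by simp
    then show ?thesis using True by (auto simp: insert_index_def split: if_splits)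
  next
    case False
    then have "{a \<in> I. a < ?x} - {pick I p} = {a \<in> I. a < ?x}" using less by auto
    then show ?thesis
      unfolding eq using False card_pick_le[OF k] by (auto simp: insert_index_def split: if_splits)
  qed
  then show ?thesis using pick_card_in_set[OF x] by simp
qed

lemma principal_submatrix_carrier:
  assumes "A \<in> carrier_mat n n" and "I \<subseteq> {0..<n}"
  shows "submatrix A I I \<in> carrier_mat (card I) (card I)"
proof -
  have "{i. i < n \<and> i \<in> I} = I" using assms(2) by auto
  then show ?thesis using assms(1) by (auto simp: submatrix_def)
qed

lemma principal_submatrix_index:
  assumes "A \<in> carrier_mat n n" and "I \<subseteq> {0..<n}" and "i < card I" and "j < card I"
  shows "submatrix A I I $$ (i, j) = A $$ (pick I i, pick I j)"
proof -
  have "{i. i < n \<and> i \<in> I} = I" using assms(2) by auto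
  then show ?thesis using assms by (auto simp: submatrix_def)
qed

text \<open>Shows that the slope in \<open>det_update_diagonal\<close> is again a principal minor
  when the matrix is a principal submatrix.\<close>

lemma mat_delete_principal_submatrix:
  assumes A: "A \<in> carrier_mat n n" and I: "I \<subseteq> {0..<n}" and p: "p < card I"
  shows "mat_delete (submatrix A I I) p p = submatrix A (I - {pick I p}) (I - {pick I p})"
proof -
  have fin: "finite I" using I finite_subset by blast
  have J: "I - {pick I p} \<subseteq> {0..<n}" using I by auto
  have card: "card (I - {pick I p}) = card I - 1"
    using pick_in_set_le[OF p] fin by simp
  note S = principal_submatrix_carrier[OF A I]
  note T = principal_submatrix_carrier[OF A J, unfolded card]
  show ?thesis
  proof (rule eq_matI)
    fix i j
    assume "i < dim_row (submatrix A (I - {pick I p}) (I - {pick I p}))"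
      "j < dim_col (submatrix A (I - {pick I p}) (I - {pick I p}))"
    then have i: "Suc i < card I" and j: "Suc j < card I" using T by auto
    have Suc: "card I = Suc (card I - 1)" using p by simp
    have "mat_delete (submatrix A I I) p p $$ (i, j)
        = submatrix A I I $$ (insert_index p i, insert_index p j)"
      using mat_delete_index[of "submatrix A I I" "card I - 1" p p i j] S p i j Suc by auto
    also have "\<dots> = A $$ (pick I (insert_index p i), pick I (insert_index p j))"
      using i j by (intro principal_submatrix_index[OF A I]) (auto simp: insert_index_def)
    also have "\<dots> = submatrix A (I - {pick I p}) (I - {pick I p}) $$ (i, j)"
      using i j pick_remove[OF fin p] principal_submatrix_index[OF A J] card by simp
    finally show "mat_delete (submatrix A I I) p p $$ (i, j)
        = submatrix A (I - {pick I p}) (I - {pick I p}) $$ (i, j)" .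
  qed (use S T in auto)
qed

lemma det_principal_submatrix_update_diagonal:
  fixes A :: "'a :: comm_ring_1 mat"
  assumes A: "A \<in> carrier_mat n n" and B: "B \<in> carrier_mat n n"
    and I: "I \<subseteq> {0..<n}" and x: "x \<in> I"
    and eq: "\<And>i j. i < n \<Longrightarrow> j < n \<Longrightarrow>
      B $$ (i, j) = A $$ (i, j) + (if i = x \<and> j = x then d else 0)"
  shows "det (submatrix B I I)
    = det (submatrix A I I) + d * det (submatrix A (I - {x}) (I - {x}))"
proof -
  have fin: "finite I" using I finite_subset by blast
  \<comment> \<open>Row \<open>x\<close> of the full matrix becomes row \<open>p\<close> of the
    submatrix.\<close>
  define p where "p = card {a \<in> I. a < x}"
  have px: "pick I p = x" unfolding p_def by (rule pick_card_in_set[OF x])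
  have p: "p < card I"
    unfolding p_def using x by (intro psubset_card_mono[OF fin]) auto
  have "submatrix B I I $$ (i, j)
      = submatrix A I I $$ (i, j) + (if i = p \<and> j = p then d else 0)"
    if "i < card I" "j < card I" for i j
  proof -
    have "pick I i < n" "pick I j < n" using that I pick_in_set_le by fastforce+
    moreover have "pick I i = x \<longleftrightarrow> i = p" "pick I j = x \<longleftrightarrow> j = p"
      using that p px pick_eq_iff by blast+
    ultimately show ?thesis
      using principal_submatrix_index[OF A I that] principal_submatrix_index[OF B I that] eq by simp
  qed
  then show ?thesis
    using det_update_diagonal[OF principal_submatrix_carrier[OF A I]
        principal_submatrix_carrier[OF B I] p]
      mat_delete_principal_submatrix[OF A I p] px by simp
qed

section \<open>Positivity of the real eigenvalues of a P-matrix\<close>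

lemma P_matrix_det_add_scalar_pos:
  assumes P: "P_matrix B" and B: "B \<in> carrier_mat n n" and s: "0 \<le> s"
  shows "det (B + s \<cdot>\<^sub>m 1\<^sub>m n) > 0"
proof -
  \<comment> \<open>\<open>M S\<close> interpolates between \<open>B\<close> at
    \<open>S = {}\<close> and the shifted matrix at \<open>S = {0..<n}\<close>.\<close>
  define M where "M S = mat n n (\<lambda>(i, j). B $$ (i, j) + (if i = j \<and> i \<in> S then s else 0))"
    for S
  have M: "M S \<in> carrier_mat n n" for S by (simp add: M_def)
  \<comment> \<open>The empty minor, equal to 1, is included although \<open>P_matrix\<close>
    excludes it: it is the slope of the update when \<open>I = {x}\<close>.\<close>
  have "\<forall>I \<subseteq> {0..<n}. det (submatrix (M S) I I) > 0" if "finite S" for S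
    using that
  proof (induction S)
    case empty
    have "M {} = B" using B by (intro eq_matI) (auto simp: M_def)
    moreover have "det (submatrix B {} {}) > 0"
      using principal_submatrix_carrier[OF B, of "{}"] by (simp add: det_dim_zero)
    moreover have "det (submatrix B I I) > 0" if "I \<noteq> {}" "I \<subseteq> {0..<n}" for I
      using P B that unfolding P_matrix_def by auto
    ultimately show ?case by (intro allI impI) (case_tac "I = {}", simp_all)
  next
    case (insert x S)
    show ?case
    proof (intro allI impI)
      fix I assume I: "I \<subseteq> {0..<n}"
      show "det (submatrix (M (insert x S)) I I) > 0"
      proof (cases "x \<in> I")
        case True
        have "M (insert x S) $$ (i, j) = M S $$ (i, j) + (if i = x \<and> j = x then s else 0)"
          if "i < n" "j < n" for i j
          using that insert.hyps by (auto simp: M_def)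
        from det_principal_submatrix_update_diagonal[OF M M I True this]
        have "det (submatrix (M (insert x S)) I I)
            = det (submatrix (M S) I I) + s * det (submatrix (M S) (I - {x}) (I - {x}))" .
        \<comment> \<open>Both minors belong to \<open>M S\<close>, so the induction hypothesis,
          stated for all index sets at once, covers them.\<close>
        moreover have "det (submatrix (M S) I I) > 0" "det (submatrix (M S) (I - {x}) (I - {x})) > 0"
          using insert.IH I by (blast, meson Diff_subset subset_trans)
        ultimately show ?thesis using s by (simp add: add_pos_nonneg)
      next
        case False
        have "submatrix (M (insert x S)) I I = submatrix (M S) I I"
        proof (rule eq_matI)
          fix i j assume "i < dim_row (submatrix (M S) I I)" "j < dim_col (submatrix (M S) I I)"
          then have ij: "i < card I" "j < card I"
            using principal_submatrix_carrier[OF M[of S] I] by auto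
          then have "pick I i \<in> I" "pick I j \<in> I" using pick_in_set_le by auto
          moreover from this have "pick I i < n" "pick I j < n" using I by auto
          ultimately show "submatrix (M (insert x S)) I I $$ (i, j) = submatrix (M S) I I $$ (i, j)"
            using False unfolding principal_submatrix_index[OF M I ij] by (auto simp: M_def)
        qed (simp_all add: dim_submatrix M_def)
        then show ?thesis using insert.IH I by simp
      qed
    qed
  qed
  then have "det (submatrix (M {0..<n}) {0..<n} {0..<n}) > 0" by blast
  moreover have "submatrix (M {0..<n}) {0..<n} {0..<n} = B + s \<cdot>\<^sub>m 1\<^sub>m n"
  proof (rule eq_matI)
    fix i j assume "i < dim_row (B + s \<cdot>\<^sub>m 1\<^sub>m n)" "j < dim_col (B + s \<cdot>\<^sub>m 1\<^sub>m n)"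
    then have ij: "i < n" "j < n" by auto
    \<comment> \<open>Selecting all rows and columns leaves the indices unchanged.\<close>
    have "pick {0..<n} k = k" if "k < n" for k
    proof -
      have "{a \<in> {0..<n}. a < k} = {0..<k}" using that by auto
      then show ?thesis using pick_card_in_set[of k "{0..<n}"] that by simp
    qed
    then show "submatrix (M {0..<n}) {0..<n} {0..<n} $$ (i, j) = (B + s \<cdot>\<^sub>m 1\<^sub>m n) $$ (i, j)"
      using principal_submatrix_index[OF M[of "{0..<n}"], of "{0..<n}" i j] ij B by (auto simp: M_def)
  qed (use B in \<open>simp_all add: dim_submatrix M_def\<close>)
  ultimately show ?thesis by simp
qed

text \<open>For \<open>r\<close> at most 0, the characteristic matrix at \<open>r\<close> is
  \<open>B\<close> shifted by the nonnegative scalar \<open>- r\<close>, hence nonsingular.\<close>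

lemma P_matrix_real_eigenvalue_pos:
  assumes P: "P_matrix B" and B: "B \<in> carrier_mat n n" and "eigenvalue B r"
  shows "r > 0"
proof (rule ccontr)
  assume "\<not> r > 0"
  then have "det (char_matrix B r) > 0"
    using P_matrix_det_add_scalar_pos[OF P B, of "- r"] B by (simp add: char_matrix_def)
  then show False using assms(3) eigenvalue_det[OF B] by simp
qed

section \<open>Eigenvalues of the exponential\<close>

lemma mat_exp_carrier: "A \<in> carrier_mat n n \<Longrightarrow> mat_exp A \<in> carrier_mat n n"
  by (simp add: mat_exp_def)

text \<open>An eigenvector \<open>v\<close> for \<open>z\<close> satisfies
  \<open>A ^ k v = z ^ k v\<close> for every \<open>k\<close>. Dividing by \<open>fact k\<close> and
  summing shows that \<open>v\<close> is an eigenvector of the exponential for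
  \<open>exp z\<close>.\<close>

lemma eigenvalue_mat_exp:
  fixes A :: "real mat"
  assumes A: "A \<in> carrier_mat n n" and ev: "eigenvalue (map_mat complex_of_real A) z"
  shows "eigenvalue (map_mat complex_of_real (mat_exp A)) (exp z)"
proof -
  let ?c = "map_mat complex_of_real"
  have cA: "?c A \<in> carrier_mat n n" using A by simp
  obtain v where v: "eigenvector (?c A) v z" using ev unfolding eigenvalue_def by blast
  then have vn: "v \<in> carrier_vec n" and v0: "v \<noteq> 0\<^sub>v n"
    using A by (auto simp: eigenvector_def)
  have "?c (mat_exp A) *\<^sub>v v = exp z \<cdot>\<^sub>v v"
  proof (rule eq_vecI)
    fix i assume "i < dim_vec (exp z \<cdot>\<^sub>v v)"
    then have i: "i < n" using vn by auto
    have pow: "(\<Sum>j = 0..<n. complex_of_real ((A ^\<^sub>m k) $$ (i, j)) * v $ j) = z ^ k * v $ i" for k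
    proof -
      have "?c (A ^\<^sub>m k) *\<^sub>v v = z ^ k \<cdot>\<^sub>v v"
        using eigenvector_pow[OF cA v] of_real_hom.mat_hom_pow[OF A] by metis
      then have "(?c (A ^\<^sub>m k) *\<^sub>v v) $ i = z ^ k * v $ i" using i vn by simp
      then show ?thesis using i vn A by (simp add: scalar_prod_def)
    qed
    \<comment> \<open>Each entry of \<open>mat_exp A\<close> is the limit of its series by
      \<open>summable_mat_exp\<close>; the finite sum over \<open>j\<close> can then be exchanged
      with the series over \<open>k\<close>.\<close>
    have "(\<lambda>k. complex_of_real ((A ^\<^sub>m k) $$ (i, j) / fact k) * v $ j)
        sums (complex_of_real (mat_exp A $$ (i, j)) * v $ j)" if "j < n" for j
      using summable_sums[OF summable_mat_exp[OF A i that]] i that A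
      by (intro sums_mult2 sums_of_real) (simp add: mat_exp_def)
    then have "(\<lambda>k. \<Sum>j = 0..<n. complex_of_real ((A ^\<^sub>m k) $$ (i, j) / fact k) * v $ j)
        sums (\<Sum>j = 0..<n. complex_of_real (mat_exp A $$ (i, j)) * v $ j)"
      by (intro sums_sum) auto
    moreover have "(\<Sum>j = 0..<n. complex_of_real ((A ^\<^sub>m k) $$ (i, j) / fact k) * v $ j)
        = z ^ k /\<^sub>R fact k * v $ i" for k
      using pow[of k] by (simp add: scaleR_conv_of_real field_simps flip: sum_divide_distrib)
    moreover have "(\<lambda>k. z ^ k /\<^sub>R fact k * v $ i) sums (exp z * v $ i)"
      by (intro sums_mult2 exp_converges)
    ultimately have "(\<Sum>j = 0..<n. complex_of_real (mat_exp A $$ (i, j)) * v $ j) = exp z * v $ i"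
      using sums_unique2 by simp
    then show "(?c (mat_exp A) *\<^sub>v v) $ i = (exp z \<cdot>\<^sub>v v) $ i"
      using i vn mat_exp_carrier[OF A] by (simp add: scalar_prod_def)
  qed (use vn mat_exp_carrier[OF A] in auto)
  then show ?thesis
    using vn v0 mat_exp_carrier[OF A] unfolding eigenvalue_def eigenvector_def by auto
qed

lemma eigenvalue_smult:
  fixes A :: "'a :: comm_ring_1 mat"
  assumes A: "A \<in> carrier_mat n n" and "eigenvalue A z"
  shows "eigenvalue (c \<cdot>\<^sub>m A) (c * z)"
proof -
  obtain v where v: "eigenvector A v z" using assms(2) unfolding eigenvalue_def by blast
  then have vn: "v \<in> carrier_vec n" using A by (auto simp: eigenvector_def)
  have "(c \<cdot>\<^sub>m A) *\<^sub>v v = c \<cdot>\<^sub>v (A *\<^sub>v v)"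
    using A vn by (intro eq_vecI) auto
  then have "eigenvector (c \<cdot>\<^sub>m A) v (c * z)"
    using v A by (simp add: eigenvector_def smult_smult_assoc)
  then show ?thesis unfolding eigenvalue_def by blast
qed

text \<open>The eigenvector at hand may be complex, so the descent to the reals goes through the
  characteristic polynomial, which has real coefficients and the real root \<open>r\<close>.\<close>

lemma eigenvalue_map_mat_of_real:
  fixes A :: "real mat"
  assumes A: "A \<in> carrier_mat n n"
    and ev: "eigenvalue (map_mat complex_of_real A) (complex_of_real r)"
  shows "eigenvalue A r"
proof -
  have cA: "map_mat complex_of_real A \<in> carrier_mat n n" using A by simp
  have "complex_of_real (poly (char_poly A) r) = 0"
    using ev unfolding eigenvalue_root_char_poly[OF cA] of_real_hom.char_poly_hom[OF A] by simp
  then show ?thesis unfolding eigenvalue_root_char_poly[OF A] by simp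
qed

theorem theorem7:
  fixes A :: "real mat" and n :: nat and z :: complex
  assumes "A \<in> carrier_mat n n"
    and "eigenvalue (map_mat complex_of_real A) z"
    and "z \<notin> \<real>"
  shows "\<not> EP_matrix A"
proof
  assume EP: "EP_matrix A"
  note A = assms(1)
  define t where "t = pi / \<bar>Im z\<bar>"
  have Im: "Im z \<noteq> 0" using assms(3) complex_is_Real_iff by blast
  have t: "t \<ge> 0" by (simp add: t_def)
  have tA: "t \<cdot>\<^sub>m A \<in> carrier_mat n n" using A by simp
  have "map_mat complex_of_real (t \<cdot>\<^sub>m A) = complex_of_real t \<cdot>\<^sub>m map_mat complex_of_real A"
    by (intro eq_matI) auto
  then have ev: "eigenvalue (map_mat complex_of_real (t \<cdot>\<^sub>m A)) (complex_of_real t * z)"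
    using eigenvalue_smult[OF _ assms(2), of n] A by simp
  have "t * Im z = pi \<or> t * Im z = - pi"
    using Im by (auto simp: t_def abs_if)
  \<comment> \<open>At either sign the cosine is -1 and the sine is 0, so the exponential lies on
    the negative real axis.\<close>
  then have exp: "exp (complex_of_real t * z) = complex_of_real (- exp (t * Re z))"
    by (auto simp: complex_eq_iff Re_exp Im_exp)
  have "eigenvalue (mat_exp (t \<cdot>\<^sub>m A)) (- exp (t * Re z))"
    using eigenvalue_map_mat_of_real[OF mat_exp_carrier[OF tA]] eigenvalue_mat_exp[OF tA ev] exp
    by simp
  moreover have "P_matrix (mat_exp (t \<cdot>\<^sub>m A))" using EP t unfolding EP_matrix_def by blast
  ultimately have "- exp (t * Re z) > 0"
    using P_matrix_real_eigenvalue_pos mat_exp_carrier[OF tA] by blast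
  then show False using exp_gt_zero[of "t * Re z"] by linarith
qed

end
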